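(* Let $n\geqslant 2$, let $q=(q_1,\ldots,q_n)$ be a probability mass function on $\{1,\ldots,n\}$, let $\varphi\in[0,1)$, and let $(r,s)$ be a maximizer of $\mathrm{H}(q-s+r)$ over all pairs of $n$-tuples with $r_k\geqslant 0$, $s_k\geqslant 0$, $q_k-s_k+r_k\geqslant 0$ for all $k$ and $\sum_k s_k=\sum_k r_k=\varphi$. Let $\alpha>0$ be the total number of messages generated by the user per cycle of $n$ time periods, and let $i\in\{1,\ldots,n\}$ be an index satisfying $b_{i,n}=0$ (a starting index). Then, in the steady state, the buffer capacity is $$C = \alpha \max_{j\in \{1,\ldots,n\}} b_{i,j}.$$
   Context: Here $\mathrm{H}(t)=-\sum_k t_k\log_2 t_k$ is Shannon's entropy. For $i,j\in\{1,\ldots,n\}$ let $a_{i,j}=s_m-r_m$ where $m\in\{1,\ldots,n\}$ and $m\equiv i+j-1 \pmod n$. The sequence $(b_{i,j})_{j\geqslant 1}$ is defined by $b_{i,1}=\max\{a_{i,1},0\}$ and $b_{i,j}=\max\{b_{i,j-1}+a_{i,k},0\}$ for $j\geqslant 2$, where $k=j-n\lfloor\frac{j-1}{n}\rfloor$. It models the ratio of messages stored in the buffer to the total number of messages per cycle, at time $j$, when the storing strategy $s$ and forwarding strategy $r$ are applied cyclically starting from time period $i$. The steady-state buffer capacity $C$ is the largest number of messages held in the buffer once the transient phase is over, whichever period $m\in\{1,\ldots,n\}$ the process was started from; i.e. $C=\alpha\limsup_{j\to\infty} b_{m,j}$ for every $m\in\{1,\ldots,n\}$ (part of the claim is that this does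 not depend on $m$). *)

theory Defs
  imports "HOL-Probability.Probability" "HOL-Number_Theory.Cong"
begin

text \<open>
  An \<open>n\<close>-tuple of reals is a function on \<open>nat\<close> of which only the values on \<open>{1..n}\<close> are used.
\<close>

definition shannon_entropy :: "nat \<Rightarrow> (nat \<Rightarrow> real) \<Rightarrow> real" where
  "shannon_entropy n t = - (\<Sum>k = 1..n. t k * log 2 (t k))"

definition admissible_strategies ::
    "nat \<Rightarrow> nat pmf \<Rightarrow> real \<Rightarrow> (nat \<Rightarrow> real) \<times> (nat \<Rightarrow> real) \<Rightarrow> bool" where
  "admissible_strategies n q \<phi> = (\<lambda>(r, s).
     (\<forall>k\<in>{1..n}. r k \<ge> 0 \<and> s k \<ge> 0 \<and> pmf q k - s k + r k \<ge> 0) \<and>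
     (\<Sum>k = 1..n. s k) = \<phi> \<and> (\<Sum>k = 1..n. r k) = \<phi>)"

definition optimal_strategies ::
    "nat \<Rightarrow> nat pmf \<Rightarrow> real \<Rightarrow> (nat \<Rightarrow> real) \<times> (nat \<Rightarrow> real) \<Rightarrow> bool" where
  "optimal_strategies n q \<phi> =
     is_arg_max (\<lambda>(r, s). shannon_entropy n (\<lambda>k. pmf q k - s k + r k))
       (admissible_strategies n q \<phi>)"

definition cyclic_index :: "nat \<Rightarrow> nat \<Rightarrow> nat \<Rightarrow> nat" where
  "cyclic_index n i j = (THE m. m \<in> {1..n} \<and> [m = i + j - 1] (mod n))"

lemma cyclic_index_eq:
  assumes "n \<ge> 1" "i \<ge> 1" "j \<ge> 1"
  shows "cyclic_index n i j = (i + j - 2) mod n + 1"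
  unfolding cyclic_index_def
proof (rule the_equality)
  have "[(i + j - 2) mod n + 1 = (i + j - 2) + 1] (mod n)"
    by (simp add: cong_def mod_simps)
  moreover have "(i + j - 2) + 1 = i + j - 1"
    using assms by simp
  ultimately show "(i + j - 2) mod n + 1 \<in> {1..n} \<and>
      [(i + j - 2) mod n + 1 = i + j - 1] (mod n)"
    using assms by (simp add: Suc_le_eq)
next
  fix m assume m: "m \<in> {1..n} \<and> [m = i + j - 1] (mod n)"
  have "(m - 1) + 1 = m" "(i + j - 2) + 1 = i + j - 1"
    using m assms by auto
  then have "[(m - 1) + 1 = (i + j - 2) + 1] (mod n)"
    using m by metis
  then have "[m - 1 = i + j - 2] (mod n)"
    by (simp only: cong_add_rcancel_nat)
  moreover have "m - 1 < n"
    using m by auto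
  ultimately have "m - 1 = (i + j - 2) mod n"
    by (simp add: cong_def)
  then show "m = (i + j - 2) mod n + 1"
    using m by auto
qed

definition buffer_increment ::
    "nat \<Rightarrow> (nat \<Rightarrow> real) \<Rightarrow> (nat \<Rightarrow> real) \<Rightarrow> nat \<Rightarrow> nat \<Rightarrow> real" where
  "buffer_increment n r s i j = s (cyclic_index n i j) - r (cyclic_index n i j)"

text \<open>
  The level \<open>buffer_level n r s i j\<close> is meant for \<open>j \<ge> 1\<close>; the value at \<open>j = 0\<close> is a dummy.
\<close>

fun buffer_level ::
    "nat \<Rightarrow> (nat \<Rightarrow> real) \<Rightarrow> (nat \<Rightarrow> real) \<Rightarrow> nat \<Rightarrow> nat \<Rightarrow> real" where
  "buffer_level n r s i 0 = 0"
| "buffer_level n r s i (Suc 0) = max (buffer_increment n r s i 1) 0"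
| "buffer_level n r s i (Suc (Suc j)) =
     (let k = Suc (Suc j) - n * ((Suc (Suc j) - 1) div n)
      in max (buffer_level n r s i (Suc j) + buffer_increment n r s i k) 0)"

text \<open>
  The limit superior is taken in the extended reals, so that it always exists; that it is a finite
  number and the same for every starting period \<open>m\<close> is part of what the predicate asserts.
\<close>

definition steady_state_buffer_capacity ::
    "nat \<Rightarrow> real \<Rightarrow> (nat \<Rightarrow> real) \<Rightarrow> (nat \<Rightarrow> real) \<Rightarrow> real \<Rightarrow> bool" where
  "steady_state_buffer_capacity n \<alpha> r s C \<longleftrightarrow>
     (\<forall>m\<in>{1..n}. ereal C = ereal \<alpha> * limsup (\<lambda>j. ereal (buffer_level n r s m j)))"

end

theory Submission imports Defs begin

text \<open>
  The increment at time \<open>j\<close> of the process started in period \<open>i\<close> depends only on \<open>i + j\<close> modulo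
  \<open>n\<close>, so two processes in the same phase obey the same monotone recursion. As
  \<open>b\<^bsub>i,n\<^esub> = 0\<close>, the process started from \<open>i\<close> is periodic with period \<open>n\<close>. A process started
  from \<open>m\<close> begins empty and hence stays below the one started from \<open>i\<close> in the same phase; the
  next time the latter empties, so does the former, and from then on the two coincide.
\<close>

lemma buffer_increment_cong:
  assumes "i \<ge> 1" "i' \<ge> 1" "[i + j = i' + j'] (mod n)"
  shows "buffer_increment n r s i j = buffer_increment n r s i' j'"
proof -
  \<comment> \<open>Since \<open>i\<close> and \<open>i'\<close> are positive, the subtraction in
    \<open>i + j - 1\<close> does not truncate, so 1 can be cancelled.\<close>
  have "[(i + j - 1) + 1 = (i' + j' - 1) + 1] (mod n)"
    using assms by simp
  then have "[i + j - 1 = i' + j' - 1] (mod n)"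
    by (simp only: cong_add_rcancel_nat)
  then have "cyclic_index n i j = cyclic_index n i' j'"
    unfolding cyclic_index_def cong_def by simp
  then show ?thesis
    by (simp add: buffer_increment_def)
qed

text \<open>The wrapped index \<open>k\<close> is congruent to the time itself, so the increment is
  unchanged. The dummy level 0 at time 0 makes the first step an instance of the same
  recursion.\<close>

lemma buffer_level_Suc:
  assumes "i \<ge> 1"
  shows "buffer_level n r s i (Suc j) =
    max (buffer_level n r s i j + buffer_increment n r s i (Suc j)) 0"
proof (cases j)
  case (Suc l)
  have "Suc (Suc l) - n * (Suc l div n) = Suc (Suc l mod n)"
    by (simp add: minus_mult_div_eq_mod[symmetric] Suc_diff_le)
  moreover have "[i + Suc (Suc l mod n) = i + Suc (Suc l)] (mod n)"
    by (metis add_Suc_right add_Suc cong_add_lcancel_nat cong_mod_left cong_refl)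
  then have "buffer_increment n r s i (Suc (Suc l mod n)) = buffer_increment n r s i (Suc (Suc l))"
    by (rule buffer_increment_cong[OF assms assms])
  ultimately show ?thesis
    using Suc by (simp add: Let_def)
qed simp

lemma buffer_level_nonneg: "buffer_level n r s i j \<ge> 0"
  by (induction n r s i j rule: buffer_level.induct) (simp_all add: Let_def)

lemma buffer_level_mono_shift:
  assumes "i \<ge> 1" "m \<ge> 1" and phase: "[i + c = m + d] (mod n)"
    and le: "buffer_level n r s i c \<le> buffer_level n r s m d"
  shows "buffer_level n r s i (c + j) \<le> buffer_level n r s m (d + j)"
proof (induction j)
  case 0
  then show ?case using le by simp
next
  case (Suc j)
  have "[i + Suc (c + j) = m + Suc (d + j)] (mod n)"
    using cong_add[OF phase cong_refl[of "Suc j"]] by (simp add: add_ac)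
  then have "buffer_increment n r s i (Suc (c + j)) = buffer_increment n r s m (Suc (d + j))"
    using assms buffer_increment_cong by blast
  with Suc show ?case
    using assms by (simp add: buffer_level_Suc del: buffer_level.simps)
qed

lemma buffer_level_eq_shift:
  assumes "i \<ge> 1" "m \<ge> 1" "[i + c = m + d] (mod n)"
    and "buffer_level n r s i c = buffer_level n r s m d"
  shows "buffer_level n r s i (c + j) = buffer_level n r s m (d + j)"
  using assms by (intro antisym buffer_level_mono_shift) (auto simp: cong_sym)

text \<open>Times 0 and \<open>n\<close> are in phase, and the level is 0 at both, at time 0 by the
  dummy value.\<close>

lemma buffer_level_periodic:
  assumes "i \<ge> 1" "buffer_level n r s i n = 0"
  shows "buffer_level n r s i (k * n + j) = buffer_level n r s i j"
proof (induction k)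
  case (Suc k)
  have "buffer_level n r s i (n + (k * n + j)) = buffer_level n r s i (0 + (k * n + j))"
    using assms by (intro buffer_level_eq_shift) (auto simp: cong_def)
  with Suc show ?case by (simp add: add_ac)
qed simp

lemma limsup_periodic:
  fixes f :: "nat \<Rightarrow> real"
  assumes "n \<ge> 1" and period: "\<And>k j. f (k * n + j) = f j"
  shows "limsup (\<lambda>j. ereal (f j)) = ereal (MAX j\<in>{1..n}. f j)"
proof (rule antisym)
  have "f j \<le> (MAX j\<in>{1..n}. f j)" for j
  proof -
    \<comment> \<open>Residue 0 is represented by \<open>n\<close>, as the maximum ranges over
      \<open>{1..n}\<close>.\<close>
    obtain l where l: "l \<in> {1..n}" "f j = f l"
    proof (cases "j mod n = 0")
      case True
      have "f j = f 0" using period[of "j div n" 0] True by (metis div_mult_mod_eq)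
      moreover have "f n = f 0" using period[of 1 0] by simp
      ultimately show ?thesis using that[of n] assms(1) by simp
    next
      case False
      have "f j = f (j mod n)" using period[of "j div n" "j mod n"] by simp
      then show ?thesis using that[of "j mod n"] False assms(1) by (simp add: less_imp_le)
    qed
    then show ?thesis by simp
  qed
  then show "limsup (\<lambda>j. ereal (f j)) \<le> ereal (MAX j\<in>{1..n}. f j)"
    by (intro Limsup_bounded) auto
next
  obtain l where l: "l \<in> {1..n}" "(MAX j\<in>{1..n}. f j) = f l"
    using Max_in[of "f ` {1..n}"] assms(1) by fastforce
  \<comment> \<open>Along this subsequence \<open>f\<close> is constantly its maximum.\<close>
  have "strict_mono (\<lambda>k. k * n + l)"
    using assms(1) by (simp add: strict_mono_def)
  from limsup_subseq_mono[OF this, of "\<lambda>j. ereal (f j)"]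
  show "ereal (MAX j\<in>{1..n}. f j) \<le> limsup (\<lambda>j. ereal (f j))"
    unfolding l(2) by (simp add: o_def period Limsup_const)
qed

lemma limsup_buffer_level:
  assumes "i \<in> {1..n}" "m \<in> {1..n}" and empty: "buffer_level n r s i n = 0"
  shows "limsup (\<lambda>j. ereal (buffer_level n r s m j)) =
    ereal (MAX j\<in>{1..n}. buffer_level n r s i j)"
proof -
  \<comment> \<open>Time 0 from \<open>m\<close> is in phase with time \<open>?c\<close> from
    \<open>i\<close>, and time \<open>?d\<close> from \<open>m\<close> with time 0 from
    \<open>i\<close>. The summand \<open>n\<close> prevents truncation.\<close>
  let ?c = "n + m - i" and ?d = "n + i - m"
  have i: "i \<ge> 1" and m: "m \<ge> 1" and "n \<ge> 1"
    using assms by auto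
  have periodic: "buffer_level n r s i (k * n + j) = buffer_level n r s i j" for k j
    using buffer_level_periodic[OF i empty] .
  have "?c + ?d = 2 * n + 0"
    using assms(1,2) by auto
  \<comment> \<open>At phase \<open>m\<close> the process from \<open>m\<close> has level 0, the
    other a nonnegative one. After \<open>?d\<close> more steps the latter is at time
    \<open>2 * n\<close>, where it is empty by periodicity.\<close>
  have "buffer_level n r s m (0 + ?d) \<le> buffer_level n r s i (?c + ?d)"
    using assms(1,2)
    by (intro buffer_level_mono_shift[OF m i]) (auto simp: cong_def buffer_level_nonneg)
  also have "\<dots> = 0"
    by (simp only: \<open>?c + ?d = 2 * n + 0\<close> periodic buffer_level.simps)
  finally have "buffer_level n r s m ?d = buffer_level n r s i 0"
    using buffer_level_nonneg[of n r s m ?d] by simp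
  then have shift: "buffer_level n r s m (?d + j) = buffer_level n r s i (0 + j)" for j
    using assms(1,2) by (intro buffer_level_eq_shift[OF m i]) (auto simp: cong_def)
  \<comment> \<open>Dropping the first \<open>?d\<close> terms, the transient phase, does not change
    the limit superior.\<close>
  have "limsup (\<lambda>j. ereal (buffer_level n r s m j)) =
      limsup (\<lambda>j. ereal (buffer_level n r s m (j + ?d)))"
    using limsup_shift_k[of "\<lambda>j. ereal (buffer_level n r s m j)" ?d] by simp
  also have "\<dots> = limsup (\<lambda>j. ereal (buffer_level n r s i j))"
    using shift by (simp add: add.commute[of _ ?d])
  also have "\<dots> = ereal (MAX j\<in>{1..n}. buffer_level n r s i j)"
    by (rule limsup_periodic[OF \<open>n \<ge> 1\<close> periodic])
  finally show ?thesis .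
qed

theorem corollary2:
  fixes n i :: nat and q :: "nat pmf" and \<phi> \<alpha> :: real and r s :: "nat \<Rightarrow> real"
  assumes "n \<ge> 2"
    and "set_pmf q \<subseteq> {1..n}"
    and "0 \<le> \<phi>" and "\<phi> < 1"
    and "optimal_strategies n q \<phi> (r, s)"
    and "\<alpha> > 0"
    and "i \<in> {1..n}"
    and "buffer_level n r s i n = 0"
  shows "steady_state_buffer_capacity n \<alpha> r s
           (\<alpha> * (MAX j\<in>{1..n}. buffer_level n r s i j))"
  unfolding steady_state_buffer_capacity_def
  using limsup_buffer_level[OF \<open>i \<in> {1..n}\<close> _ \<open>buffer_level n r s i n = 0\<close>] by simp

end
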